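(* For all integers $n\ge k\ge 0$ and every nonnegative integer $r$, \[ S_{2,\lambda}^{(r,Y)}(n+r,k+r)=\sum_{l=k}^{n}\sum_{m=0}^{n-l}\binom{n}{l}\lambda^{n-m-l}S_{1}(n-l,m)\,S_{2,\lambda}^{Y}(l,k)\,E\big[S_{r}^{m}\big]. \]
   Context: Let $\lambda$ be a nonzero real number. Define $(x)_{0,\lambda}=1$ and $(x)_{n,\lambda}=x(x-\lambda)\cdots(x-(n-1)\lambda)$ for $n\ge1$, and the degenerate exponential $e_{\lambda}^{x}(t)=(1+\lambda t)^{x/\lambda}=\sum_{n\ge0}(x)_{n,\lambda}\frac{t^n}{n!}$. The Stirling numbers of the first kind $S_1(n,k)$ are defined by $x(x-1)\cdots(x-n+1)=\sum_{k=0}^n S_1(n,k)x^k$. Let $Y$ be a random variable whose moment generating function exists in a neighborhood of the origin, let $(Y_j)_{j\ge1}$ be mutually independent copies of $Y$, and set $S_0=0$, $S_k=Y_1+\cdots+Y_k$ for $k\ge1$. The probabilistic degenerate Stirling numbers of the second kind associated with $Y$ are defined by $\frac{1}{k!}\big(E[e_{\lambda}^{Y}(t)]-1\big)^{k}=\sum_{n=k}^{\infty}S_{2,\lambda}^{Y}(n,k)\frac{t^n}{n!}$. For $r$ a nonnegative integer, the probabilistic degenerate $r$-Stirling numbers of the second kind associated with $Y$ are defined by \[ \frac{1}{k!}\Big(E\big[e_{\lambda}^{Y}(t)\big]-1\Big)^{k}E\big[e_{\lambda}^{S_r}(t)\big]=\sum_{n=k}^{\infty}S_{2,\lambda}^{(r,Y)}(n+r,k+r)\frac{t^n}{n!},\quad(k\ge0).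 \] *)

theory Defs
  imports "HOL-Probability.Probability" "HOL-Computational_Algebra.Polynomial"
begin

definition degen_exp :: "real \<Rightarrow> real \<Rightarrow> real \<Rightarrow> real" where
  "degen_exp lam x t = (1 + lam * t) powr (x / lam)"

text \<open>Signed Stirling numbers of the first kind (the constant \<open>stirling\<close> of the distribution is
  unsigned): the coefficients of \<open>x (x - 1) \<dots> (x - n + 1)\<close>.\<close>
definition stirling1 :: "nat \<Rightarrow> nat \<Rightarrow> real" where
  "stirling1 n m = poly.coeff (\<Prod>i<n. [:- real i, 1:]) m"

definition mgf_exists_near_0 :: "'a measure \<Rightarrow> ('a \<Rightarrow> real) \<Rightarrow> bool" where
  "mgf_exists_near_0 M Y \<longleftrightarrow>
     (\<exists>\<delta>>0. \<forall>s. \<bar>s\<bar> < \<delta> \<longrightarrow> integrable M (\<lambda>\<omega>. exp (s * Y \<omega>)))"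

text \<open>The copies are indexed from 1; \<open>Ys 0\<close> is never used.\<close>
definition indep_copies :: "'a measure \<Rightarrow> ('a \<Rightarrow> real) \<Rightarrow> (nat \<Rightarrow> 'a \<Rightarrow> real) \<Rightarrow> bool" where
  "indep_copies M Y Ys \<longleftrightarrow>
     prob_space.indep_vars M (\<lambda>_. borel) Ys {1..} \<and>
     (\<forall>j\<ge>1. distr M borel (Ys j) = distr M borel Y)"

definition psum :: "(nat \<Rightarrow> 'a \<Rightarrow> real) \<Rightarrow> nat \<Rightarrow> 'a \<Rightarrow> real" where
  "psum Ys r \<omega> = (\<Sum>j=1..r. Ys j \<omega>)"

text \<open>The sequence \<open>a\<close> with \<open>f t = (\<Sum>n\<ge>k. a n * t ^ n / n!)\<close> for all \<open>t\<close> near 0. The series is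
  indexed from 0, with the entries below \<open>k\<close> set to 0. Such a sequence is unique if it exists.\<close>
definition egf_coeffs_from :: "nat \<Rightarrow> (real \<Rightarrow> real) \<Rightarrow> nat \<Rightarrow> real" where
  "egf_coeffs_from k f =
     (THE a. (\<forall>n<k. a n = 0) \<and>
             (\<forall>\<^sub>F t in nhds 0. (\<lambda>n. a n * t ^ n / fact n) sums f t))"

definition prob_degen_stirling2 ::
    "'a measure \<Rightarrow> real \<Rightarrow> ('a \<Rightarrow> real) \<Rightarrow> nat \<Rightarrow> nat \<Rightarrow> real" where
  "prob_degen_stirling2 M lam Y n k =
     egf_coeffs_from k
       (\<lambda>t. 1 / fact k * ((\<integral>\<omega>. degen_exp lam (Y \<omega>) t \<partial>M) - 1) ^ k) n"

text \<open>Both arguments are shifted by \<open>r\<close>: the value at \<open>(n + r, k + r)\<close> is the coefficient of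
  \<open>t ^ n / n!\<close> in the generating function with exponent \<open>k\<close>. Only arguments \<open>N \<ge> K \<ge> r\<close> are
  meaningful.\<close>
definition prob_degen_r_stirling2 ::
    "'a measure \<Rightarrow> real \<Rightarrow> ('a \<Rightarrow> real) \<Rightarrow> (nat \<Rightarrow> 'a \<Rightarrow> real) \<Rightarrow> nat \<Rightarrow> nat \<Rightarrow> nat \<Rightarrow> real" where
  "prob_degen_r_stirling2 M lam Y Ys r N K =
     (let k = K - r in
        egf_coeffs_from k
          (\<lambda>t. 1 / fact k * ((\<integral>\<omega>. degen_exp lam (Y \<omega>) t \<partial>M) - 1) ^ k *
               (\<integral>\<omega>. degen_exp lam (psum Ys r \<omega>) t \<partial>M)) (N - r))"

end

theory Submission
  imports Defs
begin

text \<open>Expanding \<open>(1 + lam t) powr (x / lam)\<close> by the binomial series and integrating termwise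
  (dominated convergence, with a majorant \<open>exp (c \<bar>X\<bar>)\<close> where \<open>c \<longlonglongrightarrow> 0\<close> as \<open>t \<longlonglongrightarrow> 0\<close>) shows that the
  degenerate moments of \<open>X\<close> are the Taylor coefficients of the expected degenerate exponential. Sums
  of independent copies again have a moment generating function, so this applies to both factors of
  the generating function of the \<open>r\<close>-Stirling numbers. The claim is then the Cauchy product, with the
  falling product \<open>x (x - lam) \<dots> (x - (n - 1) lam)\<close> written in powers of \<open>x\<close>.\<close>

section \<open>Uniqueness of power series expansions and of exponential coefficients\<close>

lemma has_fps_expansion_zeroD:
  fixes F :: "real fps"
  assumes "(\<lambda>_. 0) has_fps_expansion F"
  shows "F = 0"
proof (rule ccontr)
  assume "F \<noteq> 0"
  \<comment> \<open>Dividing the zero function by the leading power of \<open>F\<close> leaves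
    \<open>g\<close>, which vanishes off the origin and takes the leading coefficient
    \<open>c\<close> at it. Having an expansion, \<open>g\<close> is continuous at 0, which forces
    \<open>c = 0\<close>.\<close>
  define c where "c = fps_nth F (subdegree F)"
  define g where "g = (\<lambda>x::real. if x = 0 then c else 0)"
  have "c \<noteq> 0"
    using \<open>F \<noteq> 0\<close> by (simp add: c_def)
  have "g has_fps_expansion fps_shift (subdegree F) F"
    using has_fps_expansion_shift[OF assms order_refl, of c]
    by (simp add: c_def g_def cong: if_cong)
  from has_fps_expansion_imp_continuous[OF this, of UNIV]
  have "(g \<longlongrightarrow> c) (at 0)"
    by (simp add: isCont_def g_def)
  moreover have "(g \<longlongrightarrow> 0) (at 0)"
    by (rule tendsto_eventually) (auto simp: g_def eventually_at intro: exI[of _ 1])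
  ultimately show False
    using \<open>c \<noteq> 0\<close> LIM_unique by blast
qed

lemma has_fps_expansion_unique_real:
  fixes F G :: "real fps"
  assumes "f has_fps_expansion F" "f has_fps_expansion G"
  shows "F = G"
  using has_fps_expansion_zeroD[of "F - G"] has_fps_expansion_diff[OF assms] by simp

lemma has_fps_expansion_power_real:
  fixes F :: "real fps"
  assumes "f has_fps_expansion F"
  shows "(\<lambda>x. f x ^ k) has_fps_expansion F ^ k"
  using has_fps_expansion_prod[of "{..<k}" "\<lambda>_. f" "\<lambda>_. F"] assms by simp

lemma has_fps_expansion_sums:
  fixes F :: "real fps"
  assumes "f has_fps_expansion F"
  shows "\<forall>\<^sub>F t in nhds 0. (\<lambda>n. fps_nth F n * t ^ n) sums f t"
proof -
  have "\<forall>\<^sub>F t in nhds 0. t \<in> eball 0 (fps_conv_radius F)"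
    using assms by (intro eventually_nhds_in_open) (auto simp: has_fps_expansion_def zero_ereal_def)
  moreover have "\<forall>\<^sub>F t in nhds 0. eval_fps F t = f t"
    using assms by (simp add: has_fps_expansion_def)
  ultimately show ?thesis
  proof eventually_elim
    case (elim t)
    then have "summable (\<lambda>n. fps_nth F n * t ^ n)"
      by (intro summable_fps) (simp add: in_eball_iff)
    with elim show ?case
      by (simp add: sums_iff eval_fps_def)
  qed
qed

text \<open>Discharges the definite description: convergence of the expansion near 0 gives
  existence, and uniqueness of expansions gives uniqueness. The factor \<open>fact n\<close> passes
  from ordinary to exponential coefficients.\<close>

lemma egf_coeffs_from_eqI:
  assumes "f has_fps_expansion F" "\<And>n. n < k \<Longrightarrow> fps_nth F n = 0"
  shows "egf_coeffs_from k f n = fact n * fps_nth F n"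
proof -
  have "egf_coeffs_from k f = (\<lambda>n. fact n * fps_nth F n)"
    unfolding egf_coeffs_from_def
  proof (rule the_equality)
    show "(\<forall>n<k. fact n * fps_nth F n = 0) \<and>
        (\<forall>\<^sub>F t in nhds 0. (\<lambda>n. fact n * fps_nth F n * t ^ n / fact n) sums f t)"
      using assms(2) has_fps_expansion_sums[OF assms(1)] by simp
  next
    fix a
    assume a: "(\<forall>n<k. a n = 0) \<and> (\<forall>\<^sub>F t in nhds 0. (\<lambda>n. a n * t ^ n / fact n) sums f t)"
    then have "f has_fps_expansion Abs_fps (\<lambda>n. a n / fact n)"
      by (intro has_fps_expansionI) simp
    from has_fps_expansion_unique_real[OF this assms(1)]
    show "a = (\<lambda>n. fact n * fps_nth F n)"
      by auto
  qed
  then show ?thesis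
    by simp
qed

section \<open>Degenerate falling factorials and the degenerate exponential series\<close>

definition degen_falling :: "real \<Rightarrow> nat \<Rightarrow> real \<Rightarrow> real" where
  "degen_falling lam n x = (\<Prod>i<n. x - real i * lam)"

lemma degen_falling_gbinomial:
  assumes "lam \<noteq> 0"
  shows "degen_falling lam n x = fact n * lam ^ n * (x / lam gchoose n)"
proof -
  have "lam ^ n * (\<Prod>i<n. x / lam - real i) = (\<Prod>i<n. lam * (x / lam - real i))"
    by (simp add: prod.distrib)
  also have "\<dots> = degen_falling lam n x"
    unfolding degen_falling_def using assms by (intro prod.cong) (auto simp: field_simps)
  finally show ?thesis
    by (simp add: gbinomial_prod_rev atLeast0LessThan)
qed

text \<open>Scaling by \<open>lam ^ n\<close> turns this into the polynomial defining
  \<open>stirling1\<close>, evaluated at \<open>x / lam\<close>; each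
  \<open>lam ^ n * (x / lam) ^ m\<close> becomes \<open>lam ^ (n - m) * x ^ m\<close>.\<close>

lemma degen_falling_stirling1:
  assumes "lam \<noteq> 0"
  shows "degen_falling lam n x = (\<Sum>m=0..n. stirling1 n m * lam ^ (n - m) * x ^ m)"
proof -
  define p where "p = (\<Prod>i<n. [:- real i, 1:])"
  have "degree p \<le> n"
    using degree_prod_sum_le[of "{..<n}" "\<lambda>i. [:- real i, 1:]"] by (simp add: p_def o_def)
  have "degen_falling lam n x = lam ^ n * poly p (x / lam)"
    using assms
    by (simp add: degen_falling_gbinomial gbinomial_prod_rev atLeast0LessThan p_def poly_prod)
  also have "poly p (x / lam) = (\<Sum>m\<le>n. stirling1 n m * (x / lam) ^ m)"
    unfolding poly_altdef using \<open>degree p \<le> n\<close>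
    by (intro sum.mono_neutral_cong_left) (auto simp: stirling1_def p_def coeff_eq_0)
  also have "lam ^ n * \<dots> = (\<Sum>m=0..n. stirling1 n m * lam ^ (n - m) * x ^ m)"
    unfolding sum_distrib_left atLeast0AtMost
    using assms by (intro sum.cong) (auto simp: power_diff field_simps)
  finally show ?thesis .
qed

text \<open>Newton's binomial series with exponent \<open>x / lam\<close> at the point
  \<open>lam * t\<close>.\<close>

lemma degen_exp_sums:
  assumes "lam \<noteq> 0" "\<bar>lam * t\<bar> < 1"
  shows "(\<lambda>n. degen_falling lam n x * t ^ n / fact n) sums degen_exp lam x t"
  using gen_binomial_real[OF assms(2), of "x / lam"] assms(1)
  by (simp add: degen_falling_gbinomial degen_exp_def power_mult_distrib mult_ac)

text \<open>Replacing \<open>lam\<close> by \<open>- \<bar>lam\<bar>\<close> makes every factor of the falling product nonnegative, so the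
  absolute partial sums are bounded by another degenerate exponential.\<close>
lemma degen_partial_sum_bound:
  assumes "lam \<noteq> 0" "\<bar>lam * t\<bar> < 1"
  shows "\<bar>\<Sum>n<N. degen_falling lam n x * t ^ n / fact n\<bar>
    \<le> exp (- ln (1 - \<bar>lam * t\<bar>) / \<bar>lam\<bar> * \<bar>x\<bar>)"
proof -
  let ?a = "\<lambda>n. degen_falling (- \<bar>lam\<bar>) n \<bar>x\<bar> * \<bar>t\<bar> ^ n / fact n"
  have le: "\<bar>degen_falling lam n x\<bar> \<le> degen_falling (- \<bar>lam\<bar>) n \<bar>x\<bar>" for n
    unfolding degen_falling_def abs_prod
  proof (rule prod_mono)
    fix i
    have "\<bar>x - real i * lam\<bar> \<le> \<bar>x\<bar> + \<bar>real i * lam\<bar>"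
      by (rule abs_triangle_ineq4)
    then show "0 \<le> \<bar>x - real i * lam\<bar> \<and> \<bar>x - real i * lam\<bar> \<le> \<bar>x\<bar> - real i * - \<bar>lam\<bar>"
      by (simp add: abs_mult)
  qed
  have nonneg: "0 \<le> ?a n" for n
    using order_trans[OF abs_ge_zero le] by simp
  have sums: "?a sums degen_exp (- \<bar>lam\<bar>) \<bar>x\<bar> \<bar>t\<bar>"
    using assms by (intro degen_exp_sums) (auto simp: abs_mult)
  have "\<bar>\<Sum>n<N. degen_falling lam n x * t ^ n / fact n\<bar> \<le> (\<Sum>n<N. ?a n)"
    by (rule order_trans[OF sum_abs sum_mono])
      (auto simp: abs_mult power_abs intro!: divide_right_mono mult_right_mono le)
  also have "\<dots> \<le> degen_exp (- \<bar>lam\<bar>) \<bar>x\<bar> \<bar>t\<bar>"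
    using sum_le_suminf[OF sums_summable[OF sums], of "{..<N}"] nonneg sums by (simp add: sums_iff)
  \<comment> \<open>Here \<open>degen_exp\<close> has base \<open>1 - \<bar>lam * t\<bar>\<close>
    and exponent \<open>- \<bar>x\<bar> / \<bar>lam\<bar>\<close>. Written with \<open>exp\<close>,
    the rate multiplying \<open>\<bar>x\<bar>\<close> depends on \<open>t\<close> and
    \<open>lam\<close> only.\<close>
  also have "\<dots> = exp (- ln (1 - \<bar>lam * t\<bar>) / \<bar>lam\<bar> * \<bar>x\<bar>)"
    using assms by (simp add: degen_exp_def powr_def abs_mult)
  finally show ?thesis .
qed

section \<open>Moments and the expansion of the expected degenerate exponential\<close>

lemma power_le_fact_mult_exp:
  fixes y :: real
  assumes "0 \<le> y"
  shows "y ^ m \<le> fact m * exp y"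
proof -
  have "(\<lambda>n. y ^ n / fact n) sums exp y"
    using exp_converges[of y] by (simp add: divide_inverse mult.commute)
  then have "y ^ m / fact m \<le> exp y"
    using sum_le_suminf[of "\<lambda>n. y ^ n / fact n" "{m}"] assms by (simp add: sums_iff)
  then show ?thesis
    by (simp add: field_simps)
qed

text \<open>Whatever the signs, \<open>exp (c * \<bar>x\<bar>)\<close> is one of
  \<open>exp (c * x)\<close> and \<open>exp (- c * x)\<close>, hence at most their sum, which is
  integrable for small \<open>c\<close>.\<close>

lemma mgf_integrable_exp_abs:
  assumes "X \<in> borel_measurable M" "mgf_exists_near_0 M X"
  obtains \<delta> where "\<delta> > 0" "\<And>c. \<bar>c\<bar> < \<delta> \<Longrightarrow> integrable M (\<lambda>\<omega>. exp (c * \<bar>X \<omega>\<bar>))"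
proof -
  note [measurable] = assms(1)
  obtain \<delta> where \<delta>: "\<delta> > 0" "\<And>s. \<bar>s\<bar> < \<delta> \<Longrightarrow> integrable M (\<lambda>\<omega>. exp (s * X \<omega>))"
    using assms(2) by (auto simp: mgf_exists_near_0_def)
  show ?thesis
  proof (rule that[OF \<delta>(1)])
    fix c :: real
    assume c: "\<bar>c\<bar> < \<delta>"
    show "integrable M (\<lambda>\<omega>. exp (c * \<bar>X \<omega>\<bar>))"
    proof (rule Bochner_Integration.integrable_bound)
      show "integrable M (\<lambda>\<omega>. exp (c * X \<omega>) + exp (- c * X \<omega>))"
        using c by (intro Bochner_Integration.integrable_add \<delta>(2)) auto
      have "exp (c * \<bar>x\<bar>) \<le> \<bar>exp (c * x) + exp (- c * x)\<bar>" for x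
        by (rule order_trans[OF _ abs_ge_self]) (simp add: abs_real_def)
      then show "AE \<omega> in M. norm (exp (c * \<bar>X \<omega>\<bar>)) \<le> norm (exp (c * X \<omega>) + exp (- c * X \<omega>))"
        by simp
    qed measurable
  qed
qed

lemma mgf_integrable_power:
  assumes "X \<in> borel_measurable M" "mgf_exists_near_0 M X"
  shows "integrable M (\<lambda>\<omega>. X \<omega> ^ m)"
proof -
  note [measurable] = assms(1)
  obtain \<delta> where \<delta>: "\<delta> > 0" "\<And>c. \<bar>c\<bar> < \<delta> \<Longrightarrow> integrable M (\<lambda>\<omega>. exp (c * \<bar>X \<omega>\<bar>))"
    using mgf_integrable_exp_abs[OF assms] by blast
  \<comment> \<open>Any value strictly between 0 and \<open>\<delta>\<close> serves. The bound on
    \<open>y ^ m\<close> at \<open>y = c * \<bar>x\<bar>\<close>, divided by \<open>c ^ m\<close>,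
    gives the majorant.\<close>
  define c where "c = \<delta> / 2"
  have c: "0 < c" "\<bar>c\<bar> < \<delta>"
    using \<delta>(1) by (auto simp: c_def)
  show ?thesis
  proof (rule Bochner_Integration.integrable_bound)
    show "integrable M (\<lambda>\<omega>. fact m / c ^ m * exp (c * \<bar>X \<omega>\<bar>))"
      using \<delta>(2)[OF c(2)] by simp
    have "\<bar>x\<bar> ^ m \<le> fact m / c ^ m * exp (c * \<bar>x\<bar>)" for x
      using power_le_fact_mult_exp[of "c * \<bar>x\<bar>" m] c(1)
      by (simp add: power_mult_distrib field_simps)
    then show "AE \<omega> in M. norm (X \<omega> ^ m) \<le> norm (fact m / c ^ m * exp (c * \<bar>X \<omega>\<bar>))"
      using c(1) by (intro AE_I2) (simp add: power_abs abs_mult)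
  qed measurable
qed

lemma has_fps_expansion_expectation_degen_exp:
  assumes "X \<in> borel_measurable M" "mgf_exists_near_0 M X" "lam \<noteq> 0"
  shows "(\<lambda>t. \<integral>\<omega>. degen_exp lam (X \<omega>) t \<partial>M) has_fps_expansion
    Abs_fps (\<lambda>n. (\<integral>\<omega>. degen_falling lam n (X \<omega>) \<partial>M) / fact n)"
proof (rule has_fps_expansionI)
  note [measurable] = assms(1)
  have integrable_falling: "integrable M (\<lambda>\<omega>. degen_falling lam n (X \<omega>))" for n
    unfolding degen_falling_stirling1[OF assms(3)]
    by (intro Bochner_Integration.integrable_sum integrable_mult_right mgf_integrable_power assms)
  obtain \<delta> where \<delta>: "\<delta> > 0" "\<And>c. \<bar>c\<bar> < \<delta> \<Longrightarrow> integrable M (\<lambda>\<omega>. exp (c * \<bar>X \<omega>\<bar>))"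
    using mgf_integrable_exp_abs[OF assms(1,2)] by blast
  \<comment> \<open>The rate in the bound on the partial sums tends to 0 with \<open>t\<close>, so
    near 0 it drops below \<open>\<delta>\<close>. The majorant is then integrable and independent
    of the number of terms.\<close>
  have "((\<lambda>t. \<bar>- ln (1 - \<bar>lam * t\<bar>) / \<bar>lam\<bar>\<bar>) \<longlongrightarrow> \<bar>- ln (1 - \<bar>lam * 0\<bar>) / \<bar>lam\<bar>\<bar>) (nhds 0)"
    using assms(3) by (intro tendsto_intros) (auto simp: filterlim_ident)
  then have small: "\<forall>\<^sub>F t in nhds 0. \<bar>- ln (1 - \<bar>lam * t\<bar>) / \<bar>lam\<bar>\<bar> < \<delta>"
    using \<delta>(1) by (auto dest: order_tendstoD(2))
  have "((\<lambda>t. \<bar>lam * t\<bar>) \<longlongrightarrow> \<bar>lam * 0\<bar>) (nhds 0)"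
    by (intro tendsto_intros) (auto simp: filterlim_ident)
  then have "\<forall>\<^sub>F t in nhds 0. \<bar>lam * t\<bar> < 1"
    by (rule order_tendstoD(2)) simp
  with small show "\<forall>\<^sub>F t in nhds 0.
      (\<lambda>n. fps_nth (Abs_fps (\<lambda>n. (\<integral>\<omega>. degen_falling lam n (X \<omega>) \<partial>M) / fact n)) n * t ^ n)
        sums (\<integral>\<omega>. degen_exp lam (X \<omega>) t \<partial>M)"
  proof eventually_elim
    case (elim t)
    let ?c = "- ln (1 - \<bar>lam * t\<bar>) / \<bar>lam\<bar>"
    let ?s = "\<lambda>N \<omega>. \<Sum>n<N. degen_falling lam n (X \<omega>) * t ^ n / fact n"
    have "(\<lambda>N. \<integral>\<omega>. ?s N \<omega> \<partial>M) \<longlonglongrightarrow> (\<integral>\<omega>. degen_exp lam (X \<omega>) t \<partial>M)"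
    proof (rule integral_dominated_convergence)
      show "integrable M (\<lambda>\<omega>. exp (?c * \<bar>X \<omega>\<bar>))"
        using elim by (intro \<delta>(2))
      show "AE \<omega> in M. (\<lambda>N. ?s N \<omega>) \<longlonglongrightarrow> degen_exp lam (X \<omega>) t"
        using degen_exp_sums[OF assms(3) elim(2)] by (intro AE_I2) (simp add: sums_def)
      show "AE \<omega> in M. norm (?s N \<omega>) \<le> exp (?c * \<bar>X \<omega>\<bar>)" for N
        using degen_partial_sum_bound[OF assms(3) elim(2)] by (intro AE_I2) simp
      show "(\<lambda>\<omega>. degen_exp lam (X \<omega>) t) \<in> borel_measurable M"
        unfolding degen_exp_def by measurable
      show "?s N \<in> borel_measurable M" for N
        unfolding degen_falling_def by measurable
    qed
    moreover have "(\<integral>\<omega>. ?s N \<omega> \<partial>M) =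
        (\<Sum>n<N. (\<integral>\<omega>. degen_falling lam n (X \<omega>) \<partial>M) / fact n * t ^ n)" for N
      using integrable_falling by (subst Bochner_Integration.integral_sum) simp_all
    ultimately show ?case
      by (simp add: sums_def)
  qed
qed

section \<open>Sums of independent copies\<close>

lemma indep_copies_borel_measurable:
  assumes "prob_space M" "indep_copies M Y Ys" "j \<ge> 1"
  shows "Ys j \<in> borel_measurable M"
  using assms prob_space.indep_vars_def[OF assms(1), of "\<lambda>_. borel" Ys "{1..}"]
  by (simp add: indep_copies_def)

lemma psum_borel_measurable:
  assumes "prob_space M" "indep_copies M Y Ys"
  shows "psum Ys r \<in> borel_measurable M"
  unfolding psum_def[abs_def]
  by (intro borel_measurable_sum indep_copies_borel_measurable[OF assms]) simp

text \<open>The exponential of the sum is a product of independent integrable factors. All copies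
  share the law of \<open>Y\<close>, so the same \<open>\<delta>\<close> works for every
  \<open>r\<close>.\<close>

lemma psum_mgf_exists_near_0:
  assumes "prob_space M" "Y \<in> borel_measurable M" "mgf_exists_near_0 M Y" "indep_copies M Y Ys"
  shows "mgf_exists_near_0 M (psum Ys r)"
proof -
  interpret prob_space M by fact
  obtain \<delta> where \<delta>: "\<delta> > 0" "\<And>s. \<bar>s\<bar> < \<delta> \<Longrightarrow> integrable M (\<lambda>\<omega>. exp (s * Y \<omega>))"
    using assms(3) by (auto simp: mgf_exists_near_0_def)
  have "integrable M (\<lambda>\<omega>. exp (s * psum Ys r \<omega>))" if s: "\<bar>s\<bar> < \<delta>" for s
  proof -
    have int: "integrable M (\<lambda>\<omega>. exp (s * Ys j \<omega>))" if "j \<ge> 1" for j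
    proof -
      note meas = indep_copies_borel_measurable[OF assms(1,4) that]
      \<comment> \<open>Integrability passes from \<open>Y\<close> to its law, which is also the law
        of \<open>Ys j\<close>, and from there back to \<open>Ys j\<close>.\<close>
      have "integrable (distr M borel Y) (\<lambda>y. exp (s * y))"
        using \<delta>(2)[OF s] assms(2) by (subst integrable_distr_eq) auto
      then have "integrable (distr M borel (Ys j)) (\<lambda>y. exp (s * y))"
        using assms(4) that by (simp add: indep_copies_def)
      then show ?thesis
        using meas by (subst (asm) integrable_distr_eq) auto
    qed
    have "indep_vars (\<lambda>_. borel) Ys {1..r}"
      using assms(4) by (auto simp: indep_copies_def intro: indep_vars_subset)
    then have "indep_vars (\<lambda>_. borel) (\<lambda>j \<omega>. exp (s * Ys j \<omega>)) {1..r}"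
      by (rule indep_vars_compose2) measurable
    then have "integrable M (\<lambda>\<omega>. \<Prod>j=1..r. exp (s * Ys j \<omega>))"
      using int by (intro indep_vars_integrable) auto
    then show ?thesis
      by (simp add: psum_def sum_distrib_left exp_sum)
  qed
  with \<delta>(1) show ?thesis
    by (auto simp: mgf_exists_near_0_def)
qed

section \<open>Expected falling factorials and the Cauchy product\<close>

lemma expectation_degen_falling:
  assumes "X \<in> borel_measurable M" "mgf_exists_near_0 M X" "lam \<noteq> 0"
  shows "(\<integral>\<omega>. degen_falling lam n (X \<omega>) \<partial>M) =
    (\<Sum>m=0..n. stirling1 n m * lam ^ (n - m) * (\<integral>\<omega>. X \<omega> ^ m \<partial>M))"
  unfolding degen_falling_stirling1[OF assms(3)]
  using mgf_integrable_power[OF assms(1,2)]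
  by (subst Bochner_Integration.integral_sum) auto

theorem theorem2p2:
  fixes M :: "'a measure" and Y :: "'a \<Rightarrow> real" and Ys :: "nat \<Rightarrow> 'a \<Rightarrow> real"
    and lam :: real and n k r :: nat
  assumes "prob_space M"
    and "lam \<noteq> 0"
    and "Y \<in> borel_measurable M"
    and "mgf_exists_near_0 M Y"
    and "indep_copies M Y Ys"
    and "k \<le> n"
  shows "prob_degen_r_stirling2 M lam Y Ys r (n + r) (k + r) =
    (\<Sum>l=k..n. \<Sum>m=0..n - l.
       real (n choose l) * lam ^ (n - m - l) * stirling1 (n - l) m *
       prob_degen_stirling2 M lam Y l k * (\<integral>\<omega>. psum Ys r \<omega> ^ m \<partial>M))"
proof -
  interpret prob_space M by fact
  note psum = psum_borel_measurable[OF assms(1,5)] psum_mgf_exists_near_0[OF assms(1,3,4,5)]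
  define A where "A = Abs_fps (\<lambda>n. (\<integral>\<omega>. degen_falling lam n (Y \<omega>) \<partial>M) / fact n)"
  define G where "G = Abs_fps (\<lambda>n. (\<integral>\<omega>. degen_falling lam n (psum Ys r \<omega>) \<partial>M) / fact n)"
  define F where "F = fps_const (1 / fact k) * (A - 1) ^ k"
  let ?f = "\<lambda>t. 1 / fact k * ((\<integral>\<omega>. degen_exp lam (Y \<omega>) t \<partial>M) - 1) ^ k"
  have "(\<lambda>t. \<integral>\<omega>. degen_exp lam (Y \<omega>) t \<partial>M) has_fps_expansion A"
    unfolding A_def by (rule has_fps_expansion_expectation_degen_exp[OF assms(3,4,2)])
  then have F: "?f has_fps_expansion F"
    unfolding F_def
    by (intro has_fps_expansion_cmult_left has_fps_expansion_power_real has_fps_expansion_diff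
        has_fps_expansion_1)
  have G: "(\<lambda>t. \<integral>\<omega>. degen_exp lam (psum Ys r \<omega>) t \<partial>M) has_fps_expansion G"
    unfolding G_def by (rule has_fps_expansion_expectation_degen_exp[OF psum assms(2)])
  \<comment> \<open>The empty falling product is 1 and the total mass is 1, so \<open>A\<close> has
    constant term 1. Hence \<open>(A - 1) ^ k\<close> has no terms below degree \<open>k\<close>, as
    \<open>egf_coeffs_from k\<close> demands.\<close>
  have "fps_nth (A - 1) 0 = 0"
    by (simp add: A_def degen_falling_def prob_space)
  then have F0: "fps_nth F l = 0" if "l < k" for l
    using startsby_zero_power_prefix[of "A - 1" k] that by (simp add: F_def)
  have S2: "prob_degen_stirling2 M lam Y l k = fact l * fps_nth F l" for l
    unfolding prob_degen_stirling2_def by (rule egf_coeffs_from_eqI[OF F F0])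
  have G_nth: "fact j * fps_nth G j =
      (\<Sum>m=0..j. stirling1 j m * lam ^ (j - m) * (\<integral>\<omega>. psum Ys r \<omega> ^ m \<partial>M))" for j
    using expectation_degen_falling[OF psum assms(2)] by (simp add: G_def)
  have FG0: "fps_nth (F * G) l = 0" if "l < k" for l
    using F0 that by (simp add: fps_mult_nth)
  have "prob_degen_r_stirling2 M lam Y Ys r (n + r) (k + r) = fact n * fps_nth (F * G) n"
    unfolding prob_degen_r_stirling2_def
    using egf_coeffs_from_eqI[OF has_fps_expansion_mult[OF F G] FG0] by simp
  also have "\<dots> = (\<Sum>l=0..n. fact n * (fps_nth F l * fps_nth G (n - l)))"
    by (simp add: fps_mult_nth sum_distrib_left)
  also have "\<dots> = (\<Sum>l=k..n. fact n * (fps_nth F l * fps_nth G (n - l)))"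
    by (rule sum.mono_neutral_right) (auto simp: F0)
  \<comment> \<open>Splitting \<open>fact n\<close> as
    \<open>(n choose l) * fact l * fact (n - l)\<close> gives each factor its own factorial, so that
    \<open>S2\<close> and \<open>G_nth\<close> apply.\<close>
  also have "\<dots> = (\<Sum>l=k..n. real (n choose l) * (fact l * fps_nth F l) *
      (fact (n - l) * fps_nth G (n - l)))"
    by (intro sum.cong refl) (simp add: binomial_fact)
  also have "\<dots> = (\<Sum>l=k..n. \<Sum>m=0..n - l.
       real (n choose l) * lam ^ (n - m - l) * stirling1 (n - l) m *
       prob_degen_stirling2 M lam Y l k * (\<integral>\<omega>. psum Ys r \<omega> ^ m \<partial>M))"
    \<comment> \<open>The exponents \<open>n - l - m\<close> and \<open>n - m - l\<close> agree,
      both being \<open>n - (l + m)\<close>.\<close>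
    unfolding G_nth S2[symmetric] sum_distrib_left
    by (intro sum.cong refl) (simp add: add.commute mult_ac)
  finally show ?thesis .
qed

end
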